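(* There exist $d\ge1$ and an IFS $\mathcal{F}$ on the Euclidean space $\mathbb{R}^d$ such that the attractor $K$ of $\mathcal{F}$, equipped with its natural fractal structure $\mathbf{\Gamma}$ as a self-similar set, satisfies $$\dim^1_{\mathbf{\Gamma}}(K)=\dim^2_{\mathbf{\Gamma}}(K)\neq\dim^3_{\mathbf{\Gamma}}(K)$$ (the limits defining $\dim^1_{\mathbf{\Gamma}}(K)$ and $\dim^2_{\mathbf{\Gamma}}(K)$ existing).
   Context: IFS. An IFS on a metric space is a finite family $\mathcal{F}=\{f_i\}_{i\in I}$, $I=\{1,\dots,k\}$, of contractions (Lipschitz self-maps with constant $c_i<1$). Its attractor is the unique nonempty compact set $K$ with $K=\bigcup_{i\in I}f_i(K)$. Natural fractal structure. The natural fractal structure on $K$ as a self-similar set is the sequence $\mathbf{\Gamma}=\{\Gamma_n\}_{n\in\mathbb{N}}$ of coverings $\Gamma_n=\{f_\omega(K):\omega\in I^n\}$ of $K$, where $f_\omega=f_{\omega_1}\circ\cdots\circ f_{\omega_n}$; each $\Gamma_n$ is regarded as a family indexed by $I^n$, so the same set may appear several times, and counts and sums over elements of $\Gamma_n$ are taken with multiplicity. Dimensions. For $F\subseteq K$ let $\mathcal{A}_n(F)=\{A\in\Gamma_n:A\cap F\neq\emptyset\}$, $N_n(F)$ the number of elements of $\mathcal{A}_n(F)$, and $\delta(F,\Gamma_n)=\sup\{\operatorname{diam}(A):A\in\mathcal{A}_n(F)\}$ (Euclidean diameter). Fractal dimension I: $\dim^1_{\mathbf{\Gamma}}(F)=\lim_{n\to\infty}\frac{\log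 N_n(F)}{n\log 2}$. Fractal dimension II: $\dim^2_{\mathbf{\Gamma}}(F)=\lim_{n\to\infty}\frac{\log N_n(F)}{-\log\delta(F,\Gamma_n)}$. Fractal dimension III (assuming $\delta(F,\Gamma_n)\to0$): for $s\ge 0$ put $\mathcal{H}^s_{n,3}(F)=\inf\{\sum_{A\in\mathcal{A}_l(F)}\operatorname{diam}(A)^s:l\ge n\}$ and $\mathcal{H}^s_3(F)=\lim_{n\to\infty}\mathcal{H}^s_{n,3}(F)$; then $\dim^3_{\mathbf{\Gamma}}(F)=\inf\{s:\mathcal{H}^s_3(F)=0\}=\sup\{s:\mathcal{H}^s_3(F)=\infty\}$. *)

theory Defs
  imports "HOL-Analysis.Analysis"
begin

section \<open>The Euclidean space of dimension $d$\<close>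

text \<open>The dimension is a natural number that has to be quantified inside a formula, so points are
  sequences vanishing from index \<open>d\<close> on; this is also the carrier of the library's
  topology \<^const>\<open>Euclidean_space\<close>.\<close>

definition eucl_dist :: "nat \<Rightarrow> (nat \<Rightarrow> real) \<Rightarrow> (nat \<Rightarrow> real) \<Rightarrow> real" where
  "eucl_dist d x y = L2_set (\<lambda>i. x i - y i) {..<d}"

definition eucl_metric :: "nat \<Rightarrow> (nat \<Rightarrow> real) metric" where
  "eucl_metric d = metric ({x. \<forall>i\<ge>d. x i = 0}, eucl_dist d)"

lemma Metric_space_eucl: "Metric_space {x. \<forall>i\<ge>d. x i = 0} (eucl_dist d)"
proof
  fix x y :: "nat \<Rightarrow> real"
  show "0 \<le> eucl_dist d x y"
    by (simp add: eucl_dist_def)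
  show "eucl_dist d x y = eucl_dist d y x"
    by (simp add: eucl_dist_def L2_set_def power2_commute)
next
  fix x y :: "nat \<Rightarrow> real"
  assume "x \<in> {x. \<forall>i\<ge>d. x i = 0}" "y \<in> {x. \<forall>i\<ge>d. x i = 0}"
  moreover have "eucl_dist d x y = 0 \<longleftrightarrow> (\<forall>i<d. x i = y i)"
    by (auto simp: eucl_dist_def L2_set_eq_0_iff)
  moreover have "x = y \<longleftrightarrow> (\<forall>i<d. x i = y i) \<and> (\<forall>i\<ge>d. x i = y i)"
    by (metis ext not_le)
  ultimately show "eucl_dist d x y = 0 \<longleftrightarrow> x = y"
    by auto
next
  fix x y z :: "nat \<Rightarrow> real"
  have "(\<lambda>i. x i - z i) = (\<lambda>i. (x i - y i) + (y i - z i))"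
    by simp
  then show "eucl_dist d x z \<le> eucl_dist d x y + eucl_dist d y z"
    unfolding eucl_dist_def by (metis L2_set_triangle_ineq)
qed

lemma mspace_eucl_metric: "mspace (eucl_metric d) = {x. \<forall>i\<ge>d. x i = 0}"
  by (simp add: eucl_metric_def Metric_space.mspace_metric Metric_space_eucl)

lemma mdist_eucl_metric: "mdist (eucl_metric d) = eucl_dist d"
  by (simp add: eucl_metric_def Metric_space.mdist_metric Metric_space_eucl)


section \<open>Iterated function systems and attractors\<close>

definition contraction :: "'a metric \<Rightarrow> ('a \<Rightarrow> 'a) \<Rightarrow> bool" where
  "contraction m g \<longleftrightarrow> g \<in> mspace m \<rightarrow> mspace m \<and>
     (\<exists>c. 0 \<le> c \<and> c < 1 \<and>
        (\<forall>x\<in>mspace m. \<forall>y\<in>mspace m. mdist m (g x) (g y) \<le> c * mdist m x y))"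

text \<open>The index set is \<open>I = {1..k}\<close>, nonempty.\<close>

definition IFS :: "'a metric \<Rightarrow> nat \<Rightarrow> (nat \<Rightarrow> 'a \<Rightarrow> 'a) \<Rightarrow> bool" where
  "IFS m k f \<longleftrightarrow> 1 \<le> k \<and> (\<forall>i\<in>{1..k}. contraction m (f i))"

definition invariant_compact :: "'a metric \<Rightarrow> nat \<Rightarrow> (nat \<Rightarrow> 'a \<Rightarrow> 'a) \<Rightarrow> 'a set \<Rightarrow> bool" where
  "invariant_compact m k f K \<longleftrightarrow>
     K \<noteq> {} \<and> compactin (mtopology_of m) K \<and> K = (\<Union>i\<in>{1..k}. f i ` K)"

definition is_attractor :: "'a metric \<Rightarrow> nat \<Rightarrow> (nat \<Rightarrow> 'a \<Rightarrow> 'a) \<Rightarrow> 'a set \<Rightarrow> bool" where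
  "is_attractor m k f K \<longleftrightarrow>
     invariant_compact m k f K \<and> (\<forall>K'. invariant_compact m k f K' \<longrightarrow> K' = K)"


section \<open>Fractal structures\<close>

text \<open>A level is an indexed family of sets (index set, member function), so that equal sets with
  different indices are counted separately.\<close>

type_synonym ('i, 'a) fractal_structure = "nat \<Rightarrow> 'i set \<times> ('i \<Rightarrow> 'a set)"

definition words :: "nat \<Rightarrow> nat \<Rightarrow> nat list set" where
  "words k n = {w. set w \<subseteq> {1..k} \<and> length w = n}"

definition word_map :: "(nat \<Rightarrow> 'a \<Rightarrow> 'a) \<Rightarrow> nat list \<Rightarrow> 'a \<Rightarrow> 'a" where
  "word_map f w = foldr (\<lambda>i g. f i \<circ> g) w id"

definition natural_structure ::
    "nat \<Rightarrow> (nat \<Rightarrow> 'a \<Rightarrow> 'a) \<Rightarrow> 'a set \<Rightarrow> (nat list, 'a) fractal_structure" where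
  "natural_structure k f K n = (words k n, \<lambda>w. word_map f w ` K)"

text \<open>Indices of the members of level \<open>n\<close> that meet \<open>F\<close>.\<close>

definition meeting :: "('i, 'a) fractal_structure \<Rightarrow> 'a set \<Rightarrow> nat \<Rightarrow> 'i set" where
  "meeting \<Gamma> F n = {j \<in> fst (\<Gamma> n). snd (\<Gamma> n) j \<inter> F \<noteq> {}}"

definition meeting_count :: "('i, 'a) fractal_structure \<Rightarrow> 'a set \<Rightarrow> nat \<Rightarrow> nat" where
  "meeting_count \<Gamma> F n = card (meeting \<Gamma> F n)"

text \<open>Analogue of \<^const>\<open>diameter\<close> for the type of abstract metrics.\<close>

definition mdiam :: "'a metric \<Rightarrow> 'a set \<Rightarrow> real" where
  "mdiam m S = (if S = {} then 0 else SUP (x, y)\<in>S \<times> S. mdist m x y)"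

definition level_diam :: "'a metric \<Rightarrow> ('i, 'a) fractal_structure \<Rightarrow> 'a set \<Rightarrow> nat \<Rightarrow> real" where
  "level_diam m \<Gamma> F n = (SUP j\<in>meeting \<Gamma> F n. mdiam m (snd (\<Gamma> n) j))"


section \<open>Fractal dimensions I, II and III\<close>

definition dim1_seq :: "('i, 'a) fractal_structure \<Rightarrow> 'a set \<Rightarrow> nat \<Rightarrow> ereal" where
  "dim1_seq \<Gamma> F n = ereal (ln (real (meeting_count \<Gamma> F n)) / (real n * ln 2))"

definition frac_dim1 :: "('i, 'a) fractal_structure \<Rightarrow> 'a set \<Rightarrow> ereal" where
  "frac_dim1 \<Gamma> F = lim (dim1_seq \<Gamma> F)"

text \<open>If the level diameter is 0, the quotient below is 0 (as \<open>ln 0 = 0\<close> and \<open>x / 0 = 0\<close>), which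
  is also its value under the convention \<open>log 0 = -\<infinity>\<close>.\<close>

definition dim2_seq ::
    "'a metric \<Rightarrow> ('i, 'a) fractal_structure \<Rightarrow> 'a set \<Rightarrow> nat \<Rightarrow> ereal" where
  "dim2_seq m \<Gamma> F n =
     ereal (ln (real (meeting_count \<Gamma> F n)) / (- ln (level_diam m \<Gamma> F n)))"

definition frac_dim2 :: "'a metric \<Rightarrow> ('i, 'a) fractal_structure \<Rightarrow> 'a set \<Rightarrow> ereal" where
  "frac_dim2 m \<Gamma> F = lim (dim2_seq m \<Gamma> F)"

text \<open>Here \<open>0 powr 0 = 0\<close>. This matters only for the value at \<open>s = 0\<close> when some members have
  diameter 0, and does not affect the dimension: if the value at \<open>s = 0\<close> vanishes, then so do the
  values at all \<open>s > 0\<close>.\<close>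

definition hausdorff3_pre ::
    "'a metric \<Rightarrow> ('i, 'a) fractal_structure \<Rightarrow> 'a set \<Rightarrow> real \<Rightarrow> nat \<Rightarrow> ereal" where
  "hausdorff3_pre m \<Gamma> F s n =
     (INF l\<in>{n..}. ereal (\<Sum>j\<in>meeting \<Gamma> F l. mdiam m (snd (\<Gamma> l) j) powr s))"

definition hausdorff3 ::
    "'a metric \<Rightarrow> ('i, 'a) fractal_structure \<Rightarrow> 'a set \<Rightarrow> real \<Rightarrow> ereal" where
  "hausdorff3 m \<Gamma> F s = lim (hausdorff3_pre m \<Gamma> F s)"

lemma hausdorff3_pre_LIMSEQ: "hausdorff3_pre m \<Gamma> F s \<longlonglongrightarrow> hausdorff3 m \<Gamma> F s"
proof -
  have "incseq (hausdorff3_pre m \<Gamma> F s)"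
    unfolding incseq_def hausdorff3_pre_def by (intro allI impI INF_superset_mono) auto
  then show ?thesis
    unfolding hausdorff3_def using LIMSEQ_SUP limI by metis
qed

definition frac_dim3 :: "'a metric \<Rightarrow> ('i, 'a) fractal_structure \<Rightarrow> 'a set \<Rightarrow> ereal" where
  "frac_dim3 m \<Gamma> F = Inf {ereal s | s. 0 \<le> s \<and> hausdorff3 m \<Gamma> F s = 0}"

end

(* On the line take x/2, x/2 + 1/2 and x/4.  The attractor is [0,1], so the member of level n with
   index w has as diameter the product of the ratios along w.  There are 3^n members and the largest
   diameter is 2^(-n), so dimensions I and II are both log 3 / log 2, whatever the overlaps.
   Dimension III sees all the diameters: the sum of their s-th powers is (2 * 2^(-s) + 4^(-s))^n,
   which tends to 0 already for s = 3/2 < log 3 / log 2. *)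
theory Submission
  imports Defs
begin

declare One_nat_def [simp del]

section \<open>The line as a Euclidean space of dimension one\<close>

definition line_emb :: "real \<Rightarrow> nat \<Rightarrow> real" where
  "line_emb t = (\<lambda>i. if i = 0 then t else 0)"

lemma line_emb_0 [simp]: "line_emb t 0 = t"
  by (simp add: line_emb_def)

lemma line_emb_eq_iff [simp]: "line_emb s = line_emb t \<longleftrightarrow> s = t"
  by (metis line_emb_0)

lemma line_emb_in_mspace [simp]: "line_emb t \<in> mspace (eucl_metric 1)"
  by (simp add: mspace_eucl_metric line_emb_def)

lemma line_emb_collapse: "x \<in> mspace (eucl_metric 1) \<Longrightarrow> line_emb (x 0) = x"
  by (auto simp: mspace_eucl_metric line_emb_def fun_eq_iff)

lemma mdist_eucl_metric_1: "mdist (eucl_metric 1) x y = \<bar>x 0 - y 0\<bar>"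
  by (simp add: mdist_eucl_metric eucl_dist_def L2_set_def One_nat_def)

text \<open>Lets compactness of an abstract invariant set pass to its set of coordinates, where
  maxima and minima are available.\<close>

lemma continuous_map_line_coord:
  "continuous_map (mtopology_of (eucl_metric 1)) euclidean (\<lambda>x. x 0 :: real)"
proof -
  have "Lipschitz_continuous_map (eucl_metric 1) euclidean_metric (\<lambda>x. x 0 :: real)"
    unfolding Lipschitz_continuous_map_def
    by (auto intro!: exI[of _ 1] simp: mdist_eucl_metric_1 dist_real_def)
  from Lipschitz_continuous_imp_continuous_map[OF this] show ?thesis
    by simp
qed

lemma continuous_map_line_emb:
  "continuous_map euclidean (mtopology_of (eucl_metric 1)) line_emb"
proof -
  have "Lipschitz_continuous_map euclidean_metric (eucl_metric 1) line_emb"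
    unfolding Lipschitz_continuous_map_def
    by (auto intro!: exI[of _ 1] simp: mdist_eucl_metric_1 dist_real_def)
  from Lipschitz_continuous_imp_continuous_map[OF this] show ?thesis
    by simp
qed

text \<open>The endpoints 0 and 1 realise the supremum, so it is an attained maximum and boundedness
  comes for free.\<close>

lemma mdiam_line_emb_affine:
  assumes "0 \<le> r"
  shows "mdiam (eucl_metric 1) ((\<lambda>t. line_emb (r * t + b)) ` {0..1}) = r"
proof -
  let ?S = "(\<lambda>t. line_emb (r * t + b)) ` {0..1}"
  have "(SUP (x, y)\<in>?S \<times> ?S. mdist (eucl_metric 1) x y) = r"
  proof (rule cSup_eq_maximum)
    have "r = mdist (eucl_metric 1) (line_emb (r * 1 + b)) (line_emb (r * 0 + b))"
      using assms by (simp add: mdist_eucl_metric_1)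
    moreover have "(line_emb (r * 1 + b), line_emb (r * 0 + b)) \<in> ?S \<times> ?S"
      by (intro SigmaI imageI) auto
    ultimately show "r \<in> (\<lambda>(x, y). mdist (eucl_metric 1) x y) ` (?S \<times> ?S)"
      by (metis (no_types, lifting) case_prod_conv image_eqI)
  next
    fix z
    assume "z \<in> (\<lambda>(x, y). mdist (eucl_metric 1) x y) ` (?S \<times> ?S)"
    then obtain t u where tu: "t \<in> {0..1}" "u \<in> {0..1}" "z = \<bar>(r * t + b) - (r * u + b)\<bar>"
      by (auto simp: mdist_eucl_metric_1)
    then have "z = r * \<bar>t - u\<bar>"
      using assms by (simp add: abs_mult flip: right_diff_distrib)
    also have "\<dots> \<le> r * 1"
      using tu assms by (intro mult_left_mono) auto
    finally show "z \<le> r" by simp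
  qed
  then show ?thesis
    by (simp add: mdiam_def)
qed


section \<open>Words\<close>

lemma words_0: "words k 0 = {[]}"
  by (auto simp: words_def)

lemma words_Suc: "words k (Suc n) = (\<lambda>(i, w). i # w) ` ({1..k} \<times> words k n)"
  by (auto simp: words_def length_Suc_conv image_iff)

lemma card_words: "card (words k n) = k ^ n"
  using card_lists_length_eq[of "{1..k}" n] by (simp add: words_def)

text \<open>Distributivity: expanding the \<open>n\<close>-th power picks one summand from each
  factor, and the picks are exactly the words of length \<open>n\<close>.\<close>

lemma sum_words_prod_list:
  fixes g :: "nat \<Rightarrow> 'a :: comm_semiring_1"
  shows "(\<Sum>w\<in>words k n. prod_list (map g w)) = (\<Sum>i=1..k. g i) ^ n"
proof (induction n)
  case 0
  then show ?case by (simp add: words_0)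
next
  case (Suc n)
  have "inj_on (\<lambda>(i, w). i # w) ({1..k} \<times> words k n)"
    by (auto simp: inj_on_def)
  then have "(\<Sum>w\<in>words k (Suc n). prod_list (map g w))
      = (\<Sum>(i, w)\<in>{1..k} \<times> words k n. g i * prod_list (map g w))"
    by (simp add: words_Suc sum.reindex case_prod_unfold)
  also have "\<dots> = (\<Sum>i=1..k. g i) * (\<Sum>w\<in>words k n. prod_list (map g w))"
    by (simp add: sum_product sum.cartesian_product)
  finally show ?case
    by (simp add: Suc.IH)
qed

text \<open>Brings a power of a diameter into the product form that
  \<open>sum_words_prod_list\<close> can sum.\<close>

lemma prod_list_powr:
  fixes g :: "'a \<Rightarrow> real"
  assumes "\<And>i. i \<in> set w \<Longrightarrow> 0 \<le> g i"
  shows "prod_list (map g w) powr s = prod_list (map (\<lambda>i. g i powr s) w)"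
  using assms
proof (induction w)
  case (Cons i w)
  have "0 \<le> prod_list (map g w)"
    using Cons.prems by (intro prod_list_nonneg) auto
  with Cons show ?case
    by (simp add: powr_mult)
qed simp

text \<open>Invariance keeps each image of \<open>K\<close> inside \<open>K\<close>, and the images
  are nonempty, so every index counts.\<close>

lemma meeting_natural_structure:
  assumes K: "invariant_compact m k f K"
  shows "meeting (natural_structure k f K) K n = words k n"
proof -
  have "word_map f w ` K \<subseteq> K" if "set w \<subseteq> {1..k}" for w
    using that
  proof (induction w)
    case (Cons i w)
    then have "word_map f (i # w) ` K \<subseteq> f i ` K"
      by (auto simp: word_map_def)
    also have "\<dots> \<subseteq> K"
      using K Cons.prems unfolding invariant_compact_def by (metis UN_upper list.set_intros(1) subsetD)
    finally show ?case .
  qed (simp add: word_map_def)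
  moreover have "K \<noteq> {}"
    using K by (simp add: invariant_compact_def)
  ultimately show ?thesis
    by (fastforce simp: meeting_def natural_structure_def words_def)
qed


section \<open>The example\<close>

text \<open>The default 1/2 covers indices outside \<open>{1..3}\<close> too, so the bounds on
  \<open>ratio\<close> hold for all naturals.\<close>

definition ratio :: "nat \<Rightarrow> real" where
  "ratio i = (if i = 3 then 1/4 else 1/2)"

definition shift :: "nat \<Rightarrow> real" where
  "shift i = (if i = 2 then 1/2 else 0)"

text \<open>Going through coordinate 0 and \<open>line_emb\<close> makes every value a point of the
  line, whatever \<open>x\<close> is.\<close>

definition maps :: "nat \<Rightarrow> (nat \<Rightarrow> real) \<Rightarrow> nat \<Rightarrow> real" where
  "maps i x = line_emb (ratio i * x 0 + shift i)"

definition unit_segment :: "(nat \<Rightarrow> real) set" where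
  "unit_segment = line_emb ` {0..1}"

lemma ratio_pos: "0 < ratio i" and ratio_le_half: "ratio i \<le> 1/2"
  by (simp_all add: ratio_def)

lemma atLeastAtMost_1_3: "{1..3} = {1, 2, 3 :: nat}"
  by auto

lemma IFS_maps: "IFS (eucl_metric 1) 3 maps"
proof -
  have "mdist (eucl_metric 1) (maps i x) (maps i y) \<le> 1/2 * mdist (eucl_metric 1) x y" for i x y
  proof -
    have "mdist (eucl_metric 1) (maps i x) (maps i y) = ratio i * \<bar>x 0 - y 0\<bar>"
      using ratio_pos[of i]
      by (simp add: mdist_eucl_metric_1 maps_def abs_mult flip: right_diff_distrib)
    also have "\<dots> \<le> 1/2 * \<bar>x 0 - y 0\<bar>"
      by (intro mult_right_mono ratio_le_half) auto
    finally show ?thesis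
      by (simp add: mdist_eucl_metric_1)
  qed
  moreover have "maps i x \<in> mspace (eucl_metric 1)" for i x
    unfolding maps_def by (rule line_emb_in_mspace)
  ultimately show ?thesis
    unfolding IFS_def contraction_def by (auto intro!: exI[of _ "1/2"])
qed

section \<open>The attractor is the unit segment\<close>

lemma unit_interval_preimage:
  assumes "t \<in> {0..1}"
  obtains i u where "i \<in> {1..3}" "u \<in> {0..1}" "t = ratio i * u + shift i"
proof (cases "t \<le> 1/2")
  \<comment> \<open>The two maps of ratio 1/2 already cover the interval; the witnesses are their
    inverses at \<open>t\<close>. The third map only adds an overlap.\<close>
  case True
  with assms that[of 1 "2 * t"] show ?thesis
    by (simp add: ratio_def shift_def)
next
  case False
  with assms that[of 2 "2 * t - 1"] show ?thesis
    by (simp add: ratio_def shift_def field_simps)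
qed

lemma invariant_compact_unit_segment: "invariant_compact (eucl_metric 1) 3 maps unit_segment"
  unfolding invariant_compact_def
proof (intro conjI)
  show "unit_segment \<noteq> {}"
    by (simp add: unit_segment_def)
  show "compactin (mtopology_of (eucl_metric 1)) unit_segment"
    unfolding unit_segment_def
    by (rule image_compactin[OF _ continuous_map_line_emb]) simp
  show "unit_segment = (\<Union>i\<in>{1..3}. maps i ` unit_segment)"
  proof
    show "unit_segment \<subseteq> (\<Union>i\<in>{1..3}. maps i ` unit_segment)"
    proof
      fix x assume "x \<in> unit_segment"
      then obtain t where t: "t \<in> {0..1}" "x = line_emb t"
        by (auto simp: unit_segment_def)
      obtain i u where "i \<in> {1..3}" "u \<in> {0..1}" "t = ratio i * u + shift i"
        using unit_interval_preimage[OF t(1)] .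
      then have "i \<in> {1..3}" "line_emb u \<in> unit_segment" "x = maps i (line_emb u)"
        by (auto simp: t maps_def unit_segment_def)
      then show "x \<in> (\<Union>i\<in>{1..3}. maps i ` unit_segment)"
        by blast
    qed
    show "(\<Union>i\<in>{1..3}. maps i ` unit_segment) \<subseteq> unit_segment"
      by (auto simp: unit_segment_def maps_def ratio_def shift_def)
  qed
qed

text \<open>The coordinates of \<open>K\<close> form a compact invariant set \<open>P\<close> of
  reals. Its extreme points confine it to the unit interval; conversely, images of a single point of
  \<open>P\<close> approximate every point of that interval, and \<open>P\<close> is closed.\<close>

lemma invariant_compact_unique:
  assumes K: "invariant_compact (eucl_metric 1) 3 maps K"
  shows "K = unit_segment"
proof -
  define P where "P = (\<lambda>x. x 0) ` K"
  have "K \<subseteq> mspace (eucl_metric 1)"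
    using K compactin_subset_topspace by (fastforce simp: invariant_compact_def)
  then have K_P: "K = line_emb ` P"
    unfolding P_def image_image by (force simp: line_emb_collapse)
  have "compact P"
    using image_compactin[OF _ continuous_map_line_coord] K
    by (simp add: P_def invariant_compact_def flip: compactin_euclidean_iff)
  have "P \<noteq> {}"
    using K by (simp add: P_def invariant_compact_def)
  have "line_emb ` P = (\<Union>i\<in>{1..3}. maps i ` line_emb ` P)"
    using K unfolding invariant_compact_def K_P by blast
  also have "\<dots> = line_emb ` (\<Union>i\<in>{1..3}. (\<lambda>t. ratio i * t + shift i) ` P)"
    by (simp add: maps_def image_UN image_image)
  finally have P: "P = (\<Union>i\<in>{1..3}. (\<lambda>t. ratio i * t + shift i) ` P)"
    by (simp add: inj_image_eq_iff inj_def)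
  have "P \<subseteq> {0..1}"
  proof -
    obtain M where M: "M \<in> P" "\<forall>t\<in>P. t \<le> M"
      using compact_attains_sup[OF \<open>compact P\<close> \<open>P \<noteq> {}\<close>] by blast
    obtain m where m: "m \<in> P" "\<forall>t\<in>P. m \<le> t"
      using compact_attains_inf[OF \<open>compact P\<close> \<open>P \<noteq> {}\<close>] by blast
    obtain i t where t: "t \<in> P" "M = ratio i * t + shift i"
      using M(1) P by blast
    have "t \<le> M"
      using t M by blast
    \<comment> \<open>From \<open>t\<close> \<le> \<open>M\<close> follows \<open>M\<close> \<le>
      \<open>ratio i * M + shift i\<close>, hence \<open>M\<close> \<le>
      \<open>shift i / (1 - ratio i)\<close>, which is 0 or 1. The minimum is treated
      symmetrically.\<close>
    then have "M \<le> 1"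
      using t(2) by (simp add: ratio_def shift_def split: if_splits)
    obtain j u where u: "u \<in> P" "m = ratio j * u + shift j"
      using m(1) P by blast
    have "m \<le> u"
      using u m by blast
    then have "0 \<le> m"
      using u(2) by (simp add: ratio_def shift_def split: if_splits)
    with \<open>M \<le> 1\<close> M m show ?thesis
      by force
  qed
  moreover have "{0..1} \<subseteq> P"
  proof
    obtain p where p: "p \<in> P"
      using \<open>P \<noteq> {}\<close> by blast
    \<comment> \<open>The constant bounds the distance from \<open>p\<close> to any point of the
      unit interval. Pulling \<open>t\<close> back along one map, approximating there and mapping
      forward again at least halves the error.\<close>
    have approx: "\<exists>y\<in>P. \<bar>y - t\<bar> \<le> (\<bar>p\<bar> + 1) * (1/2) ^ n" if "t \<in> {0..1}" for t n
      using that
    proof (induction n arbitrary: t)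
      case 0
      then show ?case
        using p by (intro bexI[of _ p]) auto
    next
      case (Suc n)
      obtain i u where iu: "i \<in> {1..3}" "u \<in> {0..1}" "t = ratio i * u + shift i"
        using unit_interval_preimage[OF Suc.prems] .
      obtain y where y: "y \<in> P" "\<bar>y - u\<bar> \<le> (\<bar>p\<bar> + 1) * (1/2) ^ n"
        using Suc.IH[OF iu(2)] by blast
      have "\<bar>(ratio i * y + shift i) - t\<bar> = ratio i * \<bar>y - u\<bar>"
        using ratio_pos[of i] by (simp add: iu(3) abs_mult flip: right_diff_distrib)
      also have "\<dots> \<le> 1/2 * ((\<bar>p\<bar> + 1) * (1/2) ^ n)"
        using y(2) ratio_le_half by (intro mult_mono) auto
      finally have "\<bar>(ratio i * y + shift i) - t\<bar> \<le> (\<bar>p\<bar> + 1) * (1/2) ^ Suc n"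
        by (simp add: mult_ac)
      moreover have "ratio i * y + shift i \<in> P"
        using iu(1) y(1) P by blast
      ultimately show ?case
        by blast
    qed
    fix t :: real
    assume t: "t \<in> {0..1}"
    have "t \<in> closure P"
      unfolding closure_approachable
    proof (intro allI impI)
      fix e :: real
      assume "0 < e"
      have "(\<lambda>n. (\<bar>p\<bar> + 1) * (1/2) ^ n) \<longlonglongrightarrow> (\<bar>p\<bar> + 1) * 0"
        by (intro tendsto_intros LIMSEQ_power_zero) auto
      then have "\<forall>\<^sub>F n in sequentially. (\<bar>p\<bar> + 1) * (1/2) ^ n < e"
        using \<open>0 < e\<close> by (intro order_tendstoD) auto
      then obtain n where "(\<bar>p\<bar> + 1) * (1/2) ^ n < e"
        by (auto simp: eventually_sequentially)
      then show "\<exists>y\<in>P. dist y t < e"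
        using approx[OF t, of n] by (force simp: dist_real_def)
    qed
    then show "t \<in> P"
      using \<open>compact P\<close> by (simp add: compact_imp_closed)
  qed
  ultimately show ?thesis
    by (simp add: K_P unit_segment_def)
qed

section \<open>Diameters of the members of each level\<close>

lemma word_map_maps_affine:
  "\<exists>b. \<forall>t. word_map maps w (line_emb t) = line_emb (prod_list (map ratio w) * t + b)"
proof (induction w)
  case Nil
  show ?case by (auto simp: word_map_def intro!: exI[of _ 0])
next
  case (Cons i w)
  then obtain b where "\<forall>t. word_map maps w (line_emb t) = line_emb (prod_list (map ratio w) * t + b)"
    by blast
  \<comment> \<open>The outer map scales the old translation \<open>b\<close> and adds its
    own.\<close>
  then have "\<forall>t. word_map maps (i # w) (line_emb t)
      = line_emb (prod_list (map ratio (i # w)) * t + (ratio i * b + shift i))"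
    by (simp add: word_map_def maps_def algebra_simps)
  then show ?case by blast
qed

text \<open>The member is an affine image of the whole interval; its unknown translation does not
  affect the diameter.\<close>

lemma mdiam_word_map:
  "mdiam (eucl_metric 1) (word_map maps w ` unit_segment) = prod_list (map ratio w)"
proof -
  obtain b where "\<forall>t. word_map maps w (line_emb t) = line_emb (prod_list (map ratio w) * t + b)"
    using word_map_maps_affine by blast
  then have "word_map maps w ` unit_segment
      = (\<lambda>t. line_emb (prod_list (map ratio w) * t + b)) ` {0..1}"
    by (simp add: unit_segment_def image_image)
  moreover have "0 \<le> prod_list (map ratio w)"
    using ratio_pos by (intro prod_list_nonneg) (auto simp: less_imp_le)
  ultimately show ?thesis
    by (simp only: mdiam_line_emb_affine)
qed

abbreviation segment_structure :: "(nat list, nat \<Rightarrow> real) fractal_structure" where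
  "segment_structure \<equiv> natural_structure 3 maps unit_segment"

lemmas meeting_segment = meeting_natural_structure[OF invariant_compact_unit_segment]

lemma mdiam_segment_structure:
  "mdiam (eucl_metric 1) (snd (segment_structure n) w) = prod_list (map ratio w)"
  by (simp only: natural_structure_def snd_conv mdiam_word_map)

text \<open>The word \<open>1...1\<close> uses only the ratio 1/2 and attains the maximum; letters 3
  can only shrink the product.\<close>

lemma level_diam_segment_structure:
  "level_diam (eucl_metric 1) segment_structure unit_segment n = (1/2) ^ n"
proof -
  have "(SUP w\<in>words 3 n. prod_list (map ratio w)) = (1/2) ^ n"
  proof (rule cSup_eq_maximum)
    have "replicate n 1 \<in> words 3 n"
      by (auto simp: words_def)
    moreover have "prod_list (map ratio (replicate n 1)) = (1/2) ^ n"
      by (induction n) (auto simp: ratio_def)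
    ultimately show "(1/2) ^ n \<in> (\<lambda>w. prod_list (map ratio w)) ` words 3 n"
      by (metis image_eqI)
  next
    \<comment> \<open>Nonnegativity is carried through the induction because multiplying the two
      upper bounds requires it.\<close>
    have "0 \<le> prod_list (map ratio w) \<and> prod_list (map ratio w) \<le> (1/2) ^ length w" for w
    proof (induction w)
      case (Cons i w)
      then show ?case
        using mult_mono[OF ratio_le_half[of i], of "prod_list (map ratio w)" "(1/2) ^ length w"]
          ratio_pos[of i] by simp
    qed simp
    then show "z \<le> (1/2) ^ n" if "z \<in> (\<lambda>w. prod_list (map ratio w)) ` words 3 n" for z
      using that by (auto simp: words_def)
  qed
  then show ?thesis
    by (simp only: level_diam_def meeting_segment mdiam_segment_structure)
qed

section \<open>The three dimensions\<close>

lemma dim1_seq_segment: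
  "dim1_seq segment_structure unit_segment = (\<lambda>n. ereal (if n = 0 then 0 else ln 3 / ln 2))"
  \<comment> \<open>At level 0 the denominator vanishes and division by 0 gives 0; afterwards
    \<open>n\<close> cancels.\<close>
  by (auto simp: fun_eq_iff dim1_seq_def meeting_count_def meeting_segment card_words ln_realpow)

text \<open>Since \<open>- ln ((1/2) ^ n)\<close> equals \<open>n * ln 2\<close>, the denominators
  agree at every level, including level 0 where both are 0.\<close>

lemma dim2_seq_segment:
  "dim2_seq (eucl_metric 1) segment_structure unit_segment = dim1_seq segment_structure unit_segment"
  by (intro ext, simp only: dim2_seq_def dim1_seq_def level_diam_segment_structure)
     (simp add: ln_realpow ln_div)

lemma LIMSEQ_dim1_seq_segment:
  "dim1_seq segment_structure unit_segment \<longlonglongrightarrow> ereal (ln 3 / ln 2)"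
  unfolding dim1_seq_segment
  by (rule tendsto_eventually) (auto intro!: eventually_sequentiallyI[of 1])

text \<open>The sum of the powers of the ratios is 1 at the exponent log_2 (1 + sqrt 2), about 1.27,
  and smaller beyond it. The exponent 3/2 lies between this value and log_2 3, about 1.58, and
  reduces all powers to square roots.\<close>

lemma hausdorff3_segment: "hausdorff3 (eucl_metric 1) segment_structure unit_segment (3/2) = 0"
proof -
  define q :: real where "q = (\<Sum>i=1..3. ratio i powr (3/2))"
  have sum: "(\<Sum>w\<in>words 3 n. prod_list (map ratio w) powr (3/2)) = q ^ n" for n
    using ratio_pos by (simp add: q_def prod_list_powr less_imp_le sum_words_prod_list)
  have half: "(1/2) powr (3/2) = 1/2 * sqrt (1/2 :: real)"
    using powr_add[of "1/2 :: real" 1 "1/2"] by (simp add: powr_half_sqrt)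
  have quarter: "(1/4) powr (3/2) = (1/8 :: real)"
    using powr_add[of "1/4 :: real" 1 "1/2"] by (simp add: powr_half_sqrt real_sqrt_divide)
  \<comment> \<open>The two ratios 1/2 together contribute \<open>sqrt (1/2)\<close>, the ratio 1/4
    contributes 1/8.\<close>
  have "q = sqrt (1/2) + 1/8"
    using half quarter by (simp add: q_def atLeastAtMost_1_3 ratio_def)
  moreover have "sqrt (1/2) < (7/8 :: real)"
    by (rule real_less_lsqrt) (simp_all add: power2_eq_square)
  ultimately have q: "0 \<le> q" "q < 1"
    by auto
  \<comment> \<open>Each tail of a nonnegative null sequence has infimum 0, so the value is 0 before
    the limit in \<open>n\<close> is taken.\<close>
  have "(INF l\<in>{n..}. ereal (q ^ l)) = 0" for n
  proof (rule antisym)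
    have "(\<lambda>l. ereal (q ^ l)) \<longlonglongrightarrow> ereal 0"
      using q by (intro tendsto_intros LIMSEQ_power_zero) auto
    then show "(INF l\<in>{n..}. ereal (q ^ l)) \<le> 0"
      unfolding zero_ereal_def by (rule LIMSEQ_le_const) (auto intro!: exI[of _ n] INF_lower)
    show "0 \<le> (INF l\<in>{n..}. ereal (q ^ l))"
      using q by (auto intro!: INF_greatest)
  qed
  then have "hausdorff3_pre (eucl_metric 1) segment_structure unit_segment (3/2) = (\<lambda>n. 0)"
    by (intro ext) (simp only: hausdorff3_pre_def meeting_segment mdiam_segment_structure sum)
  then show ?thesis
    by (simp add: hausdorff3_def limI)
qed

text \<open>This is 8 < 9 after taking logarithms.\<close>

lemma log2_3_gt: "3/2 < ln 3 / ln (2 :: real)"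
proof -
  have "3 * ln 2 = ln (2 ^ 3 :: real)" "2 * ln 3 = ln (3 ^ 2 :: real)"
    by (simp_all add: ln_realpow del: power_numeral)
  moreover have "ln (2 ^ 3 :: real) < ln (3 ^ 2)"
    by (subst ln_less_cancel_iff) auto
  ultimately show ?thesis
    by (simp add: field_simps)
qed

theorem mainTheorem7:
  shows "\<exists>(d::nat) (k::nat) (f :: nat \<Rightarrow> (nat \<Rightarrow> real) \<Rightarrow> (nat \<Rightarrow> real)) K.
    d \<ge> 1 \<and>
    IFS (eucl_metric d) k f \<and>
    is_attractor (eucl_metric d) k f K \<and>
    convergent (dim1_seq (natural_structure k f K) K) \<and>
    convergent (dim2_seq (eucl_metric d) (natural_structure k f K) K) \<and>
    frac_dim1 (natural_structure k f K) K = frac_dim2 (eucl_metric d) (natural_structure k f K) K \<and>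
    frac_dim2 (eucl_metric d) (natural_structure k f K) K
      \<noteq> frac_dim3 (eucl_metric d) (natural_structure k f K) K"
proof -
  \<comment> \<open>An upper bound suffices to separate dimension III from the other two: 3/2
    belongs to the set whose infimum is taken.\<close>
  have "frac_dim3 (eucl_metric 1) segment_structure unit_segment \<le> ereal (3/2)"
    unfolding frac_dim3_def using hausdorff3_segment by (intro Inf_lower) (auto intro!: exI[of _ "3/2"])
  also have "\<dots> < ereal (ln 3 / ln 2)"
    using log2_3_gt by simp
  also have "\<dots> = frac_dim2 (eucl_metric 1) segment_structure unit_segment"
    unfolding frac_dim2_def dim2_seq_segment using LIMSEQ_dim1_seq_segment by (simp add: limI)
  finally have "frac_dim2 (eucl_metric 1) segment_structure unit_segment
      \<noteq> frac_dim3 (eucl_metric 1) segment_structure unit_segment"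
    by simp
  moreover have "frac_dim1 segment_structure unit_segment
      = frac_dim2 (eucl_metric 1) segment_structure unit_segment"
    by (simp only: frac_dim1_def frac_dim2_def dim2_seq_segment)
  moreover have "convergent (dim1_seq segment_structure unit_segment)"
    using LIMSEQ_dim1_seq_segment by (rule convergentI)
  moreover have "is_attractor (eucl_metric 1) 3 maps unit_segment"
    unfolding is_attractor_def
    using invariant_compact_unit_segment invariant_compact_unique by blast
  ultimately show ?thesis
    using IFS_maps dim2_seq_segment by (metis order_refl)
qed

end
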